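(* Let $[\mu]\in\mathbb PV_n$ be a critical point of $F_n$ with $\mathrm M_\mu=c_\mu I+D_\mu$, $c_\mu\in\mathbb R$, $D_\mu\in\mathrm{Der}(\mu)$. Then there is a constant $c>0$ such that all eigenvalues of $cD_\mu$ are integers with no common divisor greater than $1$; i.e. the distinct eigenvalues of $cD_\mu$ are integers $k_1<k_2<\dots<k_r$ (with multiplicities $d_1,\dots,d_r\in\mathbb N$) that are coprime as a set.
   Context: $V_n$ is the space of bilinear maps $\mu:\mathbb C^n\times\mathbb C^n\to\mathbb C^n$ with the standard Hermitian structures. $L^\mu_XY=\mu(X,Y)$, $R^\mu_XY=\mu(Y,X)$, $\mathrm M_\mu=2\sum_i L^\mu_{X_i}(L^\mu_{X_i})^*-2\sum_i (L^\mu_{X_i})^*L^\mu_{X_i}-2\sum_i (R^\mu_{X_i})^*R^\mu_{X_i}$ for an orthonormal basis $\{X_i\}$ (a Hermitian matrix), $F_n([\mu])=\operatorname{tr}\mathrm M_\mu^2/\|\mu\|^4$. $[\mu]$ is a critical point of $F_n$ iff $\mathrm M_\mu=c_\mu I+D_\mu$ with $c_\mu\in\mathbb R$, $D_\mu\in\mathrm{Der}(\mu)$ (derivation algebra). (When $D_\mu=0$ the conclusion is read as: the only eigenvalue is $0$, $r=1$, $d_1=n$.) *)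

theory Defs
  imports "HOL-Analysis.Analysis"
begin

text \<open>An element mu of V_n (a complex-bilinear map C^n x C^n -> C^n) is encoded by its
structure constants with respect to the standard orthonormal basis e_i = axis i 1:
mu i j = mu(e_i, e_j).  The finite index type 'n plays the role of {1..n}.\<close>

type_synonym 'n bilin = "'n \<Rightarrow> 'n \<Rightarrow> complex^'n"

definition bil :: "('n::finite) bilin \<Rightarrow> complex^'n \<Rightarrow> complex^'n \<Rightarrow> complex^'n" where
  "bil \<mu> x y = (\<chi> k. \<Sum>i\<in>UNIV. \<Sum>j\<in>UNIV. x$i * y$j * (\<mu> i j)$k)"

definition adj :: "complex^'n^'m \<Rightarrow> complex^'m^'n" where
  "adj A = (\<chi> i j. cnj (A$j$i))"

text \<open>Matrices of L_{e_i} Y = mu(e_i, Y) and R_{e_i} Y = mu(Y, e_i).\<close>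
definition Lmat :: "('n::finite) bilin \<Rightarrow> 'n \<Rightarrow> complex^'n^'n" where
  "Lmat \<mu> i = (\<chi> k j. (\<mu> i j)$k)"

definition Rmat :: "('n::finite) bilin \<Rightarrow> 'n \<Rightarrow> complex^'n^'n" where
  "Rmat \<mu> i = (\<chi> k j. (\<mu> j i)$k)"

definition Mmu :: "('n::finite) bilin \<Rightarrow> complex^'n^'n" where
  "Mmu \<mu> = 2 *\<^sub>R (\<Sum>i\<in>UNIV. Lmat \<mu> i ** adj (Lmat \<mu> i))
          - 2 *\<^sub>R (\<Sum>i\<in>UNIV. adj (Lmat \<mu> i) ** Lmat \<mu> i)
          - 2 *\<^sub>R (\<Sum>i\<in>UNIV. adj (Rmat \<mu> i) ** Rmat \<mu> i)"

definition is_derivation :: "('n::finite) bilin \<Rightarrow> complex^'n^'n \<Rightarrow> bool" where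
  "is_derivation \<mu> D \<longleftrightarrow>
     (\<forall>x y. D *v bil \<mu> x y = bil \<mu> (D *v x) y + bil \<mu> x (D *v y))"

definition is_eigenvalue :: "complex^'n^'n \<Rightarrow> complex \<Rightarrow> bool" where
  "is_eigenvalue A l \<longleftrightarrow> (\<exists>v. v \<noteq> 0 \<and> A *v v = l *s v)"

end

(* M is Hermitian and tr (M A) = 2 <A mu, mu> for the natural action of gl_n on V_n, so tr (M A) = 0 for
   every derivation A. Diagonalise D in an orthonormal basis, with eigenvalues l_i. For additive
   f : R -> Q the operator f(D) is again a derivation, hence the sum of (c + l_i) f(l_i) vanishes.
   If f c = 0, applying f once more gives that the sum of f(l_i)^2 is 0, so f kills every l_i. As f ranges
   over all Q-linear functionals vanishing at c, all l_i lie in the rational line Q c. *)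
theory Submission
  imports Defs
begin

subsection \<open>Orthonormal eigenbases of Hermitian matrices\<close>

text \<open>The standard Hermitian form, linear in the first argument. Its real part is the inner
  product of \<open>complex^'n\<close> as a real Euclidean space, which opens the way to real
  dimension and compactness arguments.\<close>

definition hip :: "complex^'n \<Rightarrow> complex^'n \<Rightarrow> complex" where
  "hip x y = (\<Sum>i\<in>UNIV. x$i * cnj (y$i))"

lemma hip_add_left: "hip (x + y) z = hip x z + hip y z"
  by (simp add: hip_def algebra_simps sum.distrib)

lemma hip_smult_left: "hip (a *s x) z = a * hip x z"
  by (simp add: hip_def algebra_simps sum_distrib_left)

lemma hip_smult_right: "hip x (a *s z) = cnj a * hip x z"
  by (simp add: hip_def algebra_simps sum_distrib_left)

lemma hip_zero_left [simp]: "hip 0 z = 0"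
  by (simp add: hip_def)

lemma hip_scaleR_left: "hip (a *\<^sub>R x) z = of_real a * hip x z"
  by (simp add: hip_def algebra_simps sum_distrib_left scaleR_conv_of_real[where 'a = complex])

lemma cnj_hip: "cnj (hip x y) = hip y x"
  by (simp add: hip_def mult.commute)

lemma Re_hip: "Re (hip x y) = x \<bullet> y"
  by (simp add: hip_def inner_vec_def inner_complex_def)

lemma hip_self: "hip x x = of_real ((norm x)\<^sup>2)"
proof (rule complex_eqI)
  show "Re (hip x x) = Re (of_real ((norm x)\<^sup>2))"
    by (simp add: Re_hip power2_norm_eq_inner)
  show "Im (hip x x) = Im (of_real ((norm x)\<^sup>2))"
    by (simp add: hip_def algebra_simps)
qed

text \<open>The two real conditions are the vanishing of the real and the imaginary part of
  \<open>hip x y\<close>, since \<open>hip x (\<i> *s y) = - \<i> * hip x y\<close>.\<close>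

lemma hip_eq_0_if_orthogonal:
  assumes "x \<bullet> y = 0" "x \<bullet> (\<i> *s y) = 0"
  shows "hip x y = 0"
proof (rule complex_eqI)
  show "Re (hip x y) = Re 0" using assms by (simp add: Re_hip)
  have "Re (hip x (\<i> *s y)) = 0" using assms by (simp add: Re_hip)
  then show "Im (hip x y) = Im 0" by (simp add: hip_smult_right)
qed

lemma hip_matrix_vector_mult: "hip (A *v x) y = hip x (adj A *v y)"
proof -
  have "hip (A *v x) y = (\<Sum>i\<in>UNIV. \<Sum>j\<in>UNIV. A$i$j * x$j * cnj (y$i))"
    by (simp add: hip_def matrix_vector_mult_def sum_distrib_right)
  also have "\<dots> = (\<Sum>j\<in>UNIV. \<Sum>i\<in>UNIV. A$i$j * x$j * cnj (y$i))"
    by (rule sum.swap)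
  also have "\<dots> = hip x (adj A *v y)"
    by (simp add: hip_def matrix_vector_mult_def adj_def sum_distrib_left mult_ac)
  finally show ?thesis .
qed

text \<open>A maximiser of the Rayleigh quotient on the compact unit sphere of \<open>S\<close> is
  an eigenvector. Working over the reals makes the eigenvalue \<open>l\<close> real from the
  start.\<close>

lemma symmetric_eigenvector_in_subspace:
  fixes f :: "'a::euclidean_space \<Rightarrow> 'a"
  assumes f: "linear f" and sym: "\<And>x y. f x \<bullet> y = x \<bullet> f y"
    and S: "subspace S" "f ` S \<subseteq> S" "S \<noteq> {0}"
  obtains v l where "v \<in> S" "norm v = 1" "f v = l *\<^sub>R v"
proof -
  interpret f: linear f by fact
  have "compact (S \<inter> sphere 0 1)"
    by (simp add: S closed_Int_compact closed_subspace)
  moreover have "S \<inter> sphere 0 1 \<noteq> {}"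
  proof -
    obtain x where "x \<in> S" "x \<noteq> 0" using S subspace_0 by blast
    then have "(1 / norm x) *\<^sub>R x \<in> S \<inter> sphere 0 1"
      by (simp add: S subspace_scale)
    then show ?thesis by blast
  qed
  moreover have "continuous_on (S \<inter> sphere 0 1) (\<lambda>x. f x \<bullet> x)"
    by (intro continuous_intros linear_continuous_on linear_conv_bounded_linear[THEN iffD1] f)
  ultimately obtain v where v: "v \<in> S" "norm v = 1"
    and max: "\<And>x. x \<in> S \<Longrightarrow> norm x = 1 \<Longrightarrow> f x \<bullet> x \<le> f v \<bullet> v"
    using continuous_attains_sup[of "S \<inter> sphere 0 1" "\<lambda>x. f x \<bullet> x"]
    by (metis IntE IntI mem_sphere_0)
  define l where "l = f v \<bullet> v"
  have le: "f x \<bullet> x \<le> l * (x \<bullet> x)" if "x \<in> S" for x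
  proof (cases "x = 0")
    case False
    have "f ((1 / norm x) *\<^sub>R x) \<bullet> ((1 / norm x) *\<^sub>R x) \<le> l"
      unfolding l_def by (rule max) (use that False S in \<open>auto simp: subspace_scale\<close>)
    then have "f x \<bullet> x / (norm x)\<^sup>2 \<le> l"
      by (simp add: f.scaleR power2_eq_square)
    then show ?thesis using False
      by (simp add: divide_le_eq power2_norm_eq_inner)
  qed (simp add: f.zero)
  \<comment> \<open>\<open>u\<close> measures the failure of \<open>v\<close> to be an eigenvector;
    it lies in \<open>S\<close> by invariance, so \<open>v\<close> may be perturbed in its
    direction.\<close>
  define u where "u = f v - l *\<^sub>R v"
  have u: "u \<in> S" using v S by (auto simp: u_def intro!: subspace_diff subspace_scale)
  define b where "b = f u \<bullet> u - l * (u \<bullet> u)"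
  have vv: "v \<bullet> v = 1" using v by (simp add: norm_eq_1)
  \<comment> \<open>Comparing \<open>v + t *\<^sub>R u\<close> with the maximum leaves a quadratic
    in \<open>t\<close> without constant term. Its linear coefficient
    \<open>2 * (u \<bullet> u)\<close> must vanish, as the quadratic is nowhere positive.\<close>
  have ineq: "2 * t * (u \<bullet> u) + t\<^sup>2 * b \<le> 0" for t
  proof -
    have fu: "f u \<bullet> v = f v \<bullet> u" by (metis sym inner_commute)
    have "f (v + t *\<^sub>R u) \<bullet> (v + t *\<^sub>R u) \<le> l * ((v + t *\<^sub>R u) \<bullet> (v + t *\<^sub>R u))"
      by (intro le subspace_add subspace_scale S v u)
    then have "l + 2 * t * (f v \<bullet> u) + t\<^sup>2 * (f u \<bullet> u) \<le> l * (1 + 2 * t * (v \<bullet> u) + t\<^sup>2 * (u \<bullet> u))"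
      by (simp add: f.add f.scaleR inner_add_left inner_add_right l_def[symmetric] vv fu
          inner_commute[of u v] power2_eq_square algebra_simps)
    moreover have "f v \<bullet> u = u \<bullet> u + l * (v \<bullet> u)"
      by (simp add: u_def inner_diff_left inner_diff_right algebra_simps)
    ultimately show ?thesis by (simp add: b_def algebra_simps)
  qed
  have "u \<bullet> u = 0"
  proof (rule ccontr)
    assume "u \<bullet> u \<noteq> 0"
    then have a: "u \<bullet> u > 0" using inner_ge_zero[of u] by linarith
    \<comment> \<open>Small enough that \<open>t * \<bar>b\<bar>\<close> is at most
      \<open>u \<bullet> u\<close>, so the linear term wins; the added 1 covers
      \<open>b = 0\<close>.\<close>
    define t where "t = (u \<bullet> u) / (\<bar>b\<bar> + 1)"
    have t: "t > 0" using a by (simp add: t_def)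
    have "t * (2 * (u \<bullet> u) + t * b) \<le> 0"
      using ineq[of t] by (simp add: power2_eq_square algebra_simps)
    then have "2 * (u \<bullet> u) + t * b \<le> 0" using t by (simp add: mult_le_0_iff)
    moreover have "t * \<bar>b\<bar> \<le> u \<bullet> u" using a by (simp add: t_def field_simps)
    moreover have "- (t * \<bar>b\<bar>) \<le> t * b" using t by (simp add: minus_le_iff abs_if)
    ultimately show False using a by linarith
  qed
  then have "f v = l *\<^sub>R v" by (simp add: u_def)
  then show thesis using that v by blast
qed

text \<open>Induction over the index set rather than the dimension: each new eigenvector is found in
  the orthogonal complement of the earlier ones. The case \<open>I = UNIV\<close> yields a full
  eigenbasis.\<close>

lemma hermitian_orthonormal_eigenvectors:
  fixes A :: "complex^'n^'n" and I :: "'n::finite set"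
  assumes A: "adj A = A"
  shows "\<exists>v l. (\<forall>i\<in>I. \<forall>j\<in>I. hip (v i) (v j) = of_bool (i = j)) \<and>
           (\<forall>i\<in>I. A *v v i = complex_of_real (l i) *s v i)"
  using finite[of I]
proof (induction I rule: finite_induct)
  case empty
  then show ?case by simp
next
  case (insert a I)
  then obtain v l where v: "\<And>i j. i \<in> I \<Longrightarrow> j \<in> I \<Longrightarrow> hip (v i) (v j) = of_bool (i = j)"
    and l: "\<And>i. i \<in> I \<Longrightarrow> A *v v i = complex_of_real (l i) *s v i"
    by metis
  define S where "S = {x. \<forall>i\<in>I. hip x (v i) = 0}"
  have "I \<subset> UNIV" using insert by blast
  then have card: "card I < CARD('n)" by (simp add: psubset_card_mono)
  \<comment> \<open>Hermitian orthogonality to \<open>v i\<close> is real orthogonality to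
    \<open>v i\<close> and \<open>\<i> *s v i\<close>. These are at most \<open>2 * card I\<close>
    vectors, fewer than the real dimension \<open>2 * CARD('n)\<close>, so the complement
    \<open>S\<close> is nonzero.\<close>
  let ?T = "v ` I \<union> (\<lambda>i. \<i> *s v i) ` I"
  have "dim ?T \<le> card ?T"
    by (intro dim_le_card') auto
  also have "\<dots> \<le> card (v ` I) + card ((\<lambda>i. \<i> *s v i) ` I)"
    by (rule card_Un_le)
  also have "\<dots> \<le> card I + card I"
    by (intro add_mono card_image_le) auto
  also have "\<dots> < DIM(complex^'n)" using card by simp
  finally obtain x where x: "x \<noteq> 0" "\<And>y. y \<in> span ?T \<Longrightarrow> orthogonal x y"
    using orthogonal_to_subspace_exists by blast
  have "x \<in> S"
    unfolding S_def using x(2) 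
    by (auto intro!: hip_eq_0_if_orthogonal simp: orthogonal_def span_base)
  moreover have "subspace S"
    by (auto simp: subspace_def S_def hip_add_left hip_scaleR_left)
  \<comment> \<open>Invariance of \<open>S\<close>: moving \<open>A\<close> to the second argument
    turns \<open>v i\<close> into a multiple of itself.\<close>
  moreover have "(*v) A ` S \<subseteq> S"
    by (auto simp: S_def hip_matrix_vector_mult A l hip_smult_right)
  moreover have "linear ((*v) A)" by simp
  moreover have "(A *v y) \<bullet> z = y \<bullet> (A *v z)" for y z
    by (simp add: hip_matrix_vector_mult A flip: Re_hip)
  ultimately obtain w m where w: "w \<in> S" "norm w = 1" "A *v w = m *\<^sub>R w"
    using symmetric_eigenvector_in_subspace[of "(*v) A" S] x(1) by blast
  have 1: "hip w (v i) = 0" "hip (v i) w = 0" if "i \<in> I" for i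
    using w that cnj_hip[of w "v i"] by (auto simp: S_def)
  have 2: "hip w w = 1" using w by (simp add: hip_self)
  have 3: "A *v w = complex_of_real m *s w"
    using w by (simp add: vec_eq_iff scaleR_conv_of_real[where 'a = complex])
  show ?case
    by (rule exI[of _ "v(a := w)"], rule exI[of _ "l(a := m)"])
      (use insert.hyps 1 2 3 v l in \<open>auto\<close>)
qed

text \<open>The matrix \<open>U\<close> with columns \<open>v i\<close> has \<open>adj U\<close> as
  left inverse; being square, it also has it as right inverse, and
  \<open>x = U *v (adj U *v x)\<close> is the expansion.\<close>

lemma orthonormal_expansion:
  fixes v :: "'n::finite \<Rightarrow> complex^'n"
  assumes v: "\<And>i j. hip (v i) (v j) = of_bool (i = j)"
  shows "x = (\<Sum>i\<in>UNIV. hip x (v i) *s v i)"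
proof -
  define U :: "complex^'n^'n" where "U = (\<chi> k i. v i $ k)"
  have "(adj U ** U) $ i $ j = hip (v j) (v i)" for i j
    by (simp add: matrix_matrix_mult_def adj_def U_def hip_def mult.commute)
  then have "adj U ** U = mat 1"
    by (auto simp: vec_eq_iff mat_def v)
  then have "U ** adj U = mat 1" by (simp add: matrix_left_right_inverse)
  then have "x = U *v (adj U *v x)" by (simp add: matrix_vector_mul_assoc)
  also have "adj U *v x = (\<chi> i. hip x (v i))"
    by (simp add: vec_eq_iff matrix_vector_mult_def adj_def U_def hip_def mult.commute)
  also have "U *v \<dots> = (\<Sum>i\<in>UNIV. hip x (v i) *s v i)"
    by (simp add: vec_eq_iff matrix_vector_mult_def U_def mult.commute)
  finally show ?thesis .
qed

subsection \<open>The trace of the moment map against a derivation\<close>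

lemma hermitian_Mmu: "adj (Mmu \<mu>) = Mmu \<mu>"
  by (simp add: vec_eq_iff adj_def Mmu_def matrix_matrix_mult_def sum_subtractf mult.commute
      flip: sum_distrib_left)

lemma trace_adj_mult: "trace (adj X ** Y) = (\<Sum>j\<in>UNIV. hip (column j Y) (column j X))"
  by (simp add: trace_def matrix_matrix_mult_def adj_def hip_def column_def mult.commute)

lemma column_matrix_matrix_mult: "column j (A ** B) = A *v column j B"
  by (simp add: vec_eq_iff column_def matrix_matrix_mult_def matrix_vector_mult_def)

lemma matrix_vector_mult_axis: "A *v axis j 1 = column j (A :: complex^'n^'m)"
  by (simp add: vec_eq_iff column_def matrix_vector_mult_def axis_def if_distrib cong: if_cong)

lemma column_Lmat: "column j (Lmat \<mu> i) = \<mu> i j"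
  by (simp add: column_def Lmat_def vec_eq_iff)

lemma column_Rmat: "column j (Rmat \<mu> i) = \<mu> j i"
  by (simp add: column_def Rmat_def vec_eq_iff)

lemma Lmat_mult_vec: "Lmat \<mu> i *v y = bil \<mu> (axis i 1) y"
  by (simp add: vec_eq_iff bil_def matrix_vector_mult_def Lmat_def axis_def if_distrib if_distribR
      mult.commute sum.swap[of _ UNIV UNIV] cong: if_cong)

lemma Rmat_mult_vec: "Rmat \<mu> i *v y = bil \<mu> y (axis i 1)"
  by (simp add: vec_eq_iff bil_def matrix_vector_mult_def Rmat_def axis_def if_distrib if_distribR
      mult.commute cong: if_cong)

lemma bil_axis: "bil \<mu> (axis i 1) (axis j 1) = \<mu> i j"
  by (simp add: matrix_vector_mult_axis column_Lmat flip: Lmat_mult_vec)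

lemma matrix_add_mult: "(A + B) ** C = A ** C + B ** (C :: complex^'n^'n)"
  by (simp add: vec_eq_iff matrix_matrix_mult_def sum.distrib algebra_simps)

lemma matrix_sum_mult: "(\<Sum>i\<in>I. f i) ** A = (\<Sum>i\<in>I. f i ** (A :: complex^'n^'n))"
  by (induction I rule: infinite_finite_induct) (simp_all add: matrix_add_mult)

lemma trace_sum: "trace (\<Sum>i\<in>I. f i) = (\<Sum>i\<in>I. trace (f i :: complex^'n^'n))"
  by (induction I rule: infinite_finite_induct) (simp_all add: trace_add trace_0[unfolded mat_0])

lemma matrix_sub_mult: "(A - B) ** C = A ** C - B ** (C :: complex^'n^'n)"
  by (simp add: vec_eq_iff matrix_matrix_mult_def sum_subtractf algebra_simps)

lemma scaleR_matrix_mult: "(r *\<^sub>R A) ** B = r *\<^sub>R (A ** (B :: complex^'n^'n))"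
  by (simp add: vec_eq_iff matrix_matrix_mult_def scaleR_sum_right)

lemma trace_scaleR: "trace (r *\<^sub>R A) = r *\<^sub>R trace (A :: complex^'n^'n)"
  by (simp add: trace_def scaleR_sum_right)

lemma hip_diff_left: "hip (x - y) z = hip x z - hip y z"
  by (simp add: hip_def algebra_simps sum_subtractf)

text \<open>The sum is the Hermitian product of \<open>A\<close> acting on \<open>\<mu>\<close> with
  \<open>\<mu>\<close> itself, for the infinitesimal action of gl_n. The three sums in
  \<open>Mmu\<close> supply, in order, the terms with \<open>A\<close> on the value, on the second
  argument and on the first argument.\<close>

lemma trace_Mmu_mult:
  "trace (Mmu \<mu> ** A) = 2 * (\<Sum>i\<in>UNIV. \<Sum>j\<in>UNIV.
     hip (A *v \<mu> i j - bil \<mu> (A *v axis i 1) (axis j 1) - bil \<mu> (axis i 1) (A *v axis j 1)) (\<mu> i j))"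
proof -
  have 1: "trace (Lmat \<mu> i ** adj (Lmat \<mu> i) ** A) = (\<Sum>j\<in>UNIV. hip (A *v \<mu> i j) (\<mu> i j))" for i
  proof -
    have "trace (Lmat \<mu> i ** adj (Lmat \<mu> i) ** A) = trace (adj (Lmat \<mu> i) ** (A ** Lmat \<mu> i))"
      by (metis matrix_mul_assoc trace_mul_sym)
    then show ?thesis by (simp add: trace_adj_mult column_matrix_matrix_mult column_Lmat)
  qed
  have 2: "trace (adj (Lmat \<mu> i) ** Lmat \<mu> i ** A) =
      (\<Sum>j\<in>UNIV. hip (bil \<mu> (axis i 1) (A *v axis j 1)) (\<mu> i j))" for i
    by (simp add: trace_adj_mult column_matrix_matrix_mult column_Lmat Lmat_mult_vec
        matrix_vector_mult_axis flip: matrix_mul_assoc)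
  have 3: "trace (adj (Rmat \<mu> i) ** Rmat \<mu> i ** A) =
      (\<Sum>j\<in>UNIV. hip (bil \<mu> (A *v axis j 1) (axis i 1)) (\<mu> j i))" for i
    by (simp add: trace_adj_mult column_matrix_matrix_mult column_Rmat Rmat_mult_vec
        matrix_vector_mult_axis flip: matrix_mul_assoc)
  \<comment> \<open>Right multiplications carry the indices of \<open>\<mu>\<close> in reverse
    order, hence the interchange of sums.\<close>
  have 4: "(\<Sum>i\<in>UNIV. trace (adj (Rmat \<mu> i) ** Rmat \<mu> i ** A)) =
      (\<Sum>i\<in>UNIV. \<Sum>j\<in>UNIV. hip (bil \<mu> (A *v axis i 1) (axis j 1)) (\<mu> i j))"
    unfolding 3 by (rule sum.swap)
  have "trace (Mmu \<mu> ** A) = 2 * (\<Sum>i\<in>UNIV. trace (Lmat \<mu> i ** adj (Lmat \<mu> i) ** A))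
      - 2 * (\<Sum>i\<in>UNIV. trace (adj (Lmat \<mu> i) ** Lmat \<mu> i ** A))
      - 2 * (\<Sum>i\<in>UNIV. trace (adj (Rmat \<mu> i) ** Rmat \<mu> i ** A))"
    unfolding Mmu_def
    by (simp add: matrix_sub_mult scaleR_matrix_mult trace_sub trace_scaleR trace_sum
        matrix_sum_mult scaleR_conv_of_real[where 'a = complex])
  then show ?thesis
    unfolding 1 2 4 by (simp add: hip_diff_left sum_subtractf right_diff_distrib)
qed

text \<open>A derivation annihilates \<open>\<mu>\<close> under the infinitesimal action, so every
  summand of the trace formula is zero.\<close>

lemma trace_Mmu_derivation:
  assumes "is_derivation \<mu> A"
  shows "trace (Mmu \<mu> ** A) = 0"
proof -
  have "A *v \<mu> i j - bil \<mu> (A *v axis i 1) (axis j 1) - bil \<mu> (axis i 1) (A *v axis j 1) = 0" for i j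
    using assms unfolding is_derivation_def by (metis bil_axis add_diff_cancel_left' diff_self)
  then show ?thesis by (simp add: trace_Mmu_mult)
qed

subsection \<open>Rational functionals\<close>

text \<open>The reals are viewed as a vector space over the rationals. Off the line spanned by
  \<open>c\<close>, the vector \<open>x\<close> is independent of \<open>c\<close>, and a functional
  prescribed on \<open>c\<close> and \<open>x\<close> extends to all reals.\<close>

lemma rat_functional_exists:
  fixes c x :: real
  assumes x: "\<And>q. x \<noteq> of_rat q * c"
  obtains f :: "real \<Rightarrow> rat"
  where "\<And>a b. f (a + b) = f a + f b" "\<And>q a. f (of_rat q * a) = q * f a" "f c = 0" "f x \<noteq> 0"
proof -
  interpret p: vector_space_pair "\<lambda>(q::rat) (a::real). of_rat q * a" "(*) :: rat \<Rightarrow> rat \<Rightarrow> rat"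
    by unfold_locales (auto simp: algebra_simps of_rat_add of_rat_mult)
  have x0: "x \<noteq> 0" using x[of 0] by auto
  \<comment> \<open>For \<open>c = 0\<close> the set \<open>{c, x}\<close> would be dependent; then
    \<open>f c = 0\<close> holds by linearity alone.\<close>
  define B where "B = (if c = 0 then {x} else {c, x})"
  have "p.vs1.independent B"
  proof -
    have "x \<notin> p.vs1.span {c}"
      using x by (auto simp: p.vs1.span_singleton)
    then show ?thesis
      using x0 by (auto simp: B_def insert_commute[of c x] p.vs1.independent_insert p.vs1.dependent_single)
  qed
  then obtain f where f: "Vector_Spaces.linear (\<lambda>q a. of_rat q * a) (*) f"
    "\<And>y. y \<in> B \<Longrightarrow> f y = (if y = x then 1 else 0 :: rat)"
    using p.linear_independent_extend[of B "\<lambda>y. if y = x then 1 else 0"] by blast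
  interpret f: Vector_Spaces.linear "\<lambda>q a. of_rat q * a" "(*)" f by fact
  have "f c = 0" using f(2)[of c] x[of 1] f.zero by (cases "c = 0") (auto simp: B_def)
  moreover have "f x \<noteq> 0" using f(2)[of x] by (auto simp: B_def split: if_splits)
  ultimately show thesis using that f.add f.scale by blast
qed

subsection \<open>Rationality of the spectrum\<close>

lemma hip_sum_left: "hip (\<Sum>i\<in>I. f i) z = (\<Sum>i\<in>I. hip (f i) z)"
  by (induction I rule: infinite_finite_induct) (simp_all add: hip_add_left)

lemma bil_add_left: "bil \<mu> (x + y) z = bil \<mu> x z + bil \<mu> y z"
  by (simp add: vec_eq_iff bil_def algebra_simps sum.distrib)

lemma bil_add_right: "bil \<mu> x (y + z) = bil \<mu> x y + bil \<mu> x z"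
  by (simp add: vec_eq_iff bil_def algebra_simps sum.distrib)

lemma bil_smult_left: "bil \<mu> (a *s x) y = a *s bil \<mu> x y"
  by (simp add: vec_eq_iff bil_def algebra_simps sum_distrib_left)

lemma bil_smult_right: "bil \<mu> x (a *s y) = a *s bil \<mu> x y"
  by (simp add: vec_eq_iff bil_def algebra_simps sum_distrib_left)

lemma bil_zero: "bil \<mu> 0 y = 0" "bil \<mu> x 0 = 0"
  by (simp_all add: vec_eq_iff bil_def)

lemma bil_sum_left: "bil \<mu> (\<Sum>i\<in>I. f i) z = (\<Sum>i\<in>I. bil \<mu> (f i) z)"
  by (induction I rule: infinite_finite_induct) (simp_all add: bil_add_left bil_zero)

lemma bil_sum_right: "bil \<mu> z (\<Sum>i\<in>I. f i) = (\<Sum>i\<in>I. bil \<mu> z (f i))"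
  by (induction I rule: infinite_finite_induct) (simp_all add: bil_add_right bil_zero)

section \<open>Functional calculus of a diagonalised operator\<close>

locale orthonormal_eigenbasis =
  fixes D :: "complex^'n^'n" and v :: "'n::finite \<Rightarrow> complex^'n" and \<kappa> :: "'n \<Rightarrow> real"
  assumes orthonormal: "hip (v i) (v j) = of_bool (i = j)"
    and eigen: "D *v v i = complex_of_real (\<kappa> i) *s v i"
begin

lemma expansion: "x = (\<Sum>i\<in>UNIV. hip x (v i) *s v i)"
  by (rule orthonormal_expansion[OF orthonormal])

lemma eqI:
  assumes "\<And>i. hip x (v i) = hip y (v i)"
  shows "x = y"
  using expansion[of x] expansion[of y] assms by simp

lemma hip_D: "hip (D *v x) (v i) = complex_of_real (\<kappa> i) * hip x (v i)"
proof -
  have "D *v x = (\<Sum>j\<in>UNIV. hip x (v j) *s (D *v v j))"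
    by (subst (1) expansion[of x]) (simp add: vec.linear_sum vec.linear_scale matrix_vector_mul_linear_gen)
  then show ?thesis
    by (simp add: hip_sum_left hip_smult_left eigen orthonormal of_bool_def if_distrib cong: if_cong)
qed

lemma is_eigenvalue_scaled_iff:
  "is_eigenvalue (mat a ** D) z \<longleftrightarrow> (\<exists>i. z = a * complex_of_real (\<kappa> i))"
proof -
  have mult: "(mat a ** D) *v x = a *s (D *v x)" for x
    by (simp add: vec_eq_iff matrix_matrix_mult_def matrix_vector_mult_def mat_def if_distrib if_distribR
        sum_distrib_left mult.assoc cong: if_cong)
  show ?thesis
  proof
    assume "is_eigenvalue (mat a ** D) z"
    then obtain x where x: "x \<noteq> 0" "a *s (D *v x) = z *s x"
      by (auto simp: is_eigenvalue_def mult)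
    \<comment> \<open>A nonzero vector has a nonzero coefficient in the basis; comparing the
      coefficients at this index determines \<open>z\<close>.\<close>
    then obtain i where i: "hip x (v i) \<noteq> 0" using eqI[of x 0] by auto
    have "hip (a *s (D *v x)) (v i) = hip (z *s x) (v i)" using x by simp
    then show "\<exists>i. z = a * complex_of_real (\<kappa> i)"
      using i by (auto simp: hip_smult_left hip_D)
  next
    assume "\<exists>i. z = a * complex_of_real (\<kappa> i)"
    then obtain i where "z = a * complex_of_real (\<kappa> i)" by blast
    moreover have "v i \<noteq> 0" using orthonormal[of i i] by auto
    ultimately show "is_eigenvalue (mat a ** D) z"
      unfolding is_eigenvalue_def mult by (intro exI[of _ "v i"]) (simp add: eigen)
  qed
qed

text \<open>This is f(D), the sum of the orthogonal projections onto the lines of \<open>v i\<close>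
  weighted by \<open>f (\<kappa> i)\<close>.\<close>

definition calculus :: "(real \<Rightarrow> complex) \<Rightarrow> complex^'n^'n" where
  "calculus f = (\<chi> a b. \<Sum>i\<in>UNIV. f (\<kappa> i) * v i $ a * cnj (v i $ b))"

lemma calculus_mult_vec: "calculus f *v x = (\<Sum>i\<in>UNIV. (f (\<kappa> i) * hip x (v i)) *s v i)"
proof -
  have "(calculus f *v x) $ a = (\<Sum>b\<in>UNIV. \<Sum>i\<in>UNIV. f (\<kappa> i) * v i $ a * cnj (v i $ b) * x $ b)" for a
    by (simp add: calculus_def matrix_vector_mult_def sum_distrib_right)
  also have "\<dots> a = (\<Sum>i\<in>UNIV. \<Sum>b\<in>UNIV. f (\<kappa> i) * v i $ a * cnj (v i $ b) * x $ b)" for a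
    by (rule sum.swap)
  finally show ?thesis
    by (simp add: vec_eq_iff hip_def sum_distrib_left sum_distrib_right mult_ac)
qed

lemma hip_calculus: "hip (calculus f *v x) (v i) = f (\<kappa> i) * hip x (v i)"
  by (simp add: calculus_mult_vec hip_sum_left hip_smult_left orthonormal of_bool_def if_distrib cong: if_cong)

text \<open>Only coefficients with \<open>\<kappa> i = l\<close> can be nonzero. Here
  \<open>x\<close> need not be a basis vector and may be zero, as needed for products of
  eigenvectors.\<close>

lemma calculus_eigenvector:
  assumes "D *v x = complex_of_real l *s x"
  shows "calculus f *v x = f l *s x"
proof (rule eqI)
  fix i
  have "hip x (v i) = 0 \<or> \<kappa> i = l"
    using hip_D[of x i] by (auto simp: assms hip_smult_left)
  then show "hip (calculus f *v x) (v i) = hip (f l *s x) (v i)"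
    by (auto simp: hip_calculus hip_smult_left)
qed

text \<open>By linearity this reduces to one projection onto a unit vector v, where the trace
  against \<open>M\<close> is the diagonal coefficient <Mv, v>.\<close>

lemma trace_mult_calculus: "trace (M ** calculus f) = (\<Sum>i\<in>UNIV. f (\<kappa> i) * hip (M *v v i) (v i))"
proof -
  have "trace (M ** calculus f) =
      (\<Sum>a\<in>UNIV. \<Sum>b\<in>UNIV. \<Sum>i\<in>UNIV. M $ a $ b * (f (\<kappa> i) * v i $ b * cnj (v i $ a)))"
    by (simp add: trace_def matrix_matrix_mult_def calculus_def sum_distrib_left)
  also have "\<dots> = (\<Sum>i\<in>UNIV. \<Sum>a\<in>UNIV. \<Sum>b\<in>UNIV. M $ a $ b * (f (\<kappa> i) * v i $ b * cnj (v i $ a)))"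
    by (subst (2) sum.swap) (rule sum.cong[OF refl], rule sum.swap)
  also have "\<dots> = (\<Sum>i\<in>UNIV. f (\<kappa> i) * hip (M *v v i) (v i))"
    by (simp add: hip_def matrix_vector_mult_def sum_distrib_left sum_distrib_right mult_ac)
  finally show ?thesis .
qed

text \<open>Since \<open>D\<close> is a derivation, the product of eigenvectors for \<open>a\<close> and \<open>b\<close> is \<open>0\<close> or an eigenvector
  for \<open>a + b\<close>, so additivity of \<open>f\<close> is all that is needed.\<close>

lemma is_derivation_calculus:
  assumes D: "is_derivation \<mu> D" and f: "\<And>a b. f (a + b) = f a + f b"
  shows "is_derivation \<mu> (calculus f)"
  unfolding is_derivation_def
proof (intro allI)
  fix x y
  let ?C = "(*v) (calculus f)"
  have lin: "?C (\<Sum>i\<in>UNIV. g i) = (\<Sum>i\<in>UNIV. ?C (g i))" "?C (a *s z) = a *s ?C z" 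
    for g :: "'n \<Rightarrow> _" and a z
    by (simp_all add: vec.linear_sum vec.linear_scale matrix_vector_mul_linear_gen)
  have ev: "?C (v i) = f (\<kappa> i) *s v i" for i
    by (rule calculus_eigenvector[OF eigen])
  have basis: "?C (bil \<mu> (v i) (v j)) = (f (\<kappa> i) + f (\<kappa> j)) *s bil \<mu> (v i) (v j)" for i j
  proof -
    have "D *v bil \<mu> (v i) (v j) = complex_of_real (\<kappa> i + \<kappa> j) *s bil \<mu> (v i) (v j)"
      using D unfolding is_derivation_def
      by (simp add: eigen bil_smult_left bil_smult_right vec.scale_left_distrib)
    from calculus_eigenvector[OF this] show ?thesis by (simp add: f)
  qed
  \<comment> \<open>By bilinearity the Leibniz rule follows from the basis case for arbitrary linear
    combinations; with these coefficients the combinations fold back to \<open>x\<close> and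
    \<open>y\<close>.\<close>
  define a b where "a = (\<lambda>i. hip x (v i))" and "b = (\<lambda>i. hip y (v i))"
  have "?C (bil \<mu> (\<Sum>i\<in>UNIV. a i *s v i) (\<Sum>j\<in>UNIV. b j *s v j)) =
      bil \<mu> (?C (\<Sum>i\<in>UNIV. a i *s v i)) (\<Sum>j\<in>UNIV. b j *s v j) +
      bil \<mu> (\<Sum>i\<in>UNIV. a i *s v i) (?C (\<Sum>j\<in>UNIV. b j *s v j))"
    by (simp add: bil_sum_left bil_sum_right bil_smult_left bil_smult_right lin ev basis
        vec.scale_sum_right vec.scale_left_distrib algebra_simps sum.distrib)
  then show "?C (bil \<mu> x y) = bil \<mu> (?C x) y + bil \<mu> x (?C y)"
    unfolding a_def b_def expansion[symmetric] .
qed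

lemma eigenvalue_rational_multiple:
  assumes M: "Mmu \<mu> = mat (complex_of_real c) + D" and D: "is_derivation \<mu> D"
  obtains q where "\<kappa> i = of_rat q * c"
proof (rule ccontr)
  assume "\<not> thesis"
  then have "\<And>q. \<kappa> i \<noteq> of_rat q * c" using that by blast
  then obtain f where f: "\<And>a b. f (a + b) = f a + f b" "\<And>q a. f (of_rat q * a) = q * f a"
    "f c = 0" "f (\<kappa> i) \<noteq> 0"
    using rat_functional_exists by blast
  \<comment> \<open>The values of \<open>f\<close> are embedded in the complex numbers, so that
    \<open>calculus F\<close> is a matrix; additivity of \<open>f\<close> makes it a
    derivation.\<close>
  define F where "F a = complex_of_real (of_rat (f a))" for a
  have "is_derivation \<mu> (calculus F)"
    by (rule is_derivation_calculus[OF D]) (simp add: F_def f of_rat_add)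
  then have "(\<Sum>i\<in>UNIV. F (\<kappa> i) * hip (Mmu \<mu> *v v i) (v i)) = 0"
    using trace_Mmu_derivation by (metis trace_mult_calculus)
  moreover have "Mmu \<mu> *v v i = complex_of_real (c + \<kappa> i) *s v i" for i
    by (simp add: M matrix_vector_mult_add_rdistrib eigen vec.scale_left_distrib)
      (simp add: vec_eq_iff matrix_vector_mult_def mat_def if_distrib if_distribR cong: if_cong)
  ultimately have "complex_of_real (\<Sum>i\<in>UNIV. of_rat (f (\<kappa> i)) * (c + \<kappa> i)) = 0"
    by (simp add: F_def hip_smult_left hip_add_left orthonormal vec.scale_left_distrib)
  then have *: "(\<Sum>i\<in>UNIV. of_rat (f (\<kappa> i)) * (c + \<kappa> i)) = 0" by (simp only: of_real_eq_0_iff)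
  have f0: "f 0 = 0" using f(2)[of 0 0] by simp
  have fsum: "f (\<Sum>i\<in>I. g i) = (\<Sum>i\<in>I. f (g i))" for I :: "'n set" and g
    by (induction I rule: infinite_finite_induct) (simp_all add: f f0)
  \<comment> \<open>The weights \<open>f (\<kappa> i)\<close> are rational scalars, so
    \<open>f\<close> can be applied to the real relation and pulls them out; \<open>f c = 0\<close>
    leaves a sum of rational squares.\<close>
  have "f (\<Sum>i\<in>UNIV. of_rat (f (\<kappa> i)) * (c + \<kappa> i)) = (\<Sum>i\<in>UNIV. f (\<kappa> i) * f (\<kappa> i))"
    by (simp only: fsum f) simp
  then have "(\<Sum>i\<in>UNIV. f (\<kappa> i) * f (\<kappa> i)) = 0" by (simp only: * f0)
  then have "f (\<kappa> i) * f (\<kappa> i) = 0"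
    by (subst (asm) sum_nonneg_eq_0_iff) auto
  then show False using f by simp
qed

end

section \<open>Clearing denominators and dividing out the common divisor\<close>

lemma coprime_integer_scaling:
  fixes x :: "'a::finite \<Rightarrow> real"
  assumes rat: "\<And>i. \<exists>q. x i = of_rat q * c" and nz: "x i0 \<noteq> 0"
  obtains a k where "a > 0" "\<And>i. a * x i = of_int (k i)" "Gcd (range k) = (1::int)"
proof -
  obtain q where q: "\<And>i. x i = of_rat (q i) * c" using rat by metis
  have c: "c \<noteq> 0" using q[of i0] nz by auto
  define den where "den i = snd (quotient_of (q i))" for i
  \<comment> \<open>Any common multiple of the denominators will do, since the gcd is divided out
    afterwards.\<close>
  define N where "N = (\<Prod>i\<in>UNIV. den i)"
  have den: "den i > 0" for i by (simp add: den_def quotient_of_denom_pos')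
  then have N: "N > 0" by (simp add: N_def prod_pos)
  \<comment> \<open>Dividing by \<open>\<bar>c\<bar>\<close> instead of \<open>c\<close> keeps the
    scaling factor positive; the sign of \<open>c\<close> is absorbed into the integer.\<close>
  have "\<exists>m. of_int N * (x i / \<bar>c\<bar>) = of_int m" for i
  proof -
    have "den i dvd N" unfolding N_def by (rule dvd_prodI) auto
    then obtain d where d: "N = den i * d" by auto
    have "q i = of_int (fst (quotient_of (q i))) / of_int (den i)"
      unfolding den_def by (rule quotient_of_div) simp
    then have "real_of_rat (q i) = of_int (fst (quotient_of (q i))) / of_int (den i)"
      by (metis of_rat_divide of_rat_of_int_eq)
    then have "of_int (den i) * real_of_rat (q i) = of_int (fst (quotient_of (q i)))"
      using den[of i] by simp
    moreover have "of_int N * (x i / \<bar>c\<bar>) = of_int d * (of_int (den i) * real_of_rat (q i)) * (c / \<bar>c\<bar>)"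
      unfolding d q by simp
    moreover have "c / \<bar>c\<bar> = sgn c" using c by (simp add: sgn_if)
    ultimately have "of_int N * (x i / \<bar>c\<bar>) = of_int (d * fst (quotient_of (q i))) * sgn c"
      by (simp only: of_int_mult)
    also have "\<dots> = of_int (d * fst (quotient_of (q i)) * (if c > 0 then 1 else - 1))"
      using c by (simp add: sgn_if)
    finally show ?thesis by blast
  qed
  then obtain m where m: "\<And>i. of_int N * (x i / \<bar>c\<bar>) = of_int (m i)" by metis
  define g where "g = Gcd (range m)"
  \<comment> \<open>The nonzero entry ensures that the gcd \<open>g\<close> is not zero, so division
    by it is legitimate.\<close>
  have "m i0 \<noteq> 0" using m[of i0] nz N c by auto
  then have "g \<noteq> 0" by (auto simp: g_def Gcd_0_iff)
  moreover have "g \<ge> 0" unfolding g_def by (rule Gcd_int_greater_eq_0)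
  ultimately have g: "g > 0" by linarith
  define k where "k i = m i div g" for i
  have mk: "m i = g * k i" for i by (simp add: k_def g_def)
  have "range m = (*) g ` range k" by (auto simp: mk)
  \<comment> \<open>Pulling the factor \<open>g\<close> out of the gcd of all \<open>g * k i\<close>
    and cancelling it shows that the \<open>k i\<close> are coprime.\<close>
  then have "g = normalize (g * Gcd (range k))" by (metis g_def Gcd_mult)
  then have "Gcd (range k) = 1" using g by (simp add: normalize_mult)
  moreover have "of_int N / (\<bar>c\<bar> * of_int g) * x i = of_int (k i)" for i
    using m[of i] g c by (simp add: mk field_simps)
  moreover have "of_int N / (\<bar>c\<bar> * of_int g) > 0" using N g c by simp
  ultimately show thesis using that by blast
qed

section \<open>Diagonalisation of the derivation and choice of the scaling constant\<close>

theorem theorem4p2: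
  fixes \<mu> :: "('n::finite) bilin" and c\<^sub>\<mu> :: real and D :: "complex^'n^'n"
  assumes "\<mu> \<noteq> (\<lambda>i j. 0)"
    and "Mmu \<mu> = mat (complex_of_real c\<^sub>\<mu>) + D"
    and "is_derivation \<mu> D"
  shows "\<exists>c::real. c > 0 \<and>
           (\<forall>l. is_eigenvalue (mat (complex_of_real c) ** D) l \<longrightarrow> l \<in> \<int>) \<and>
           (D \<noteq> 0 \<longrightarrow>
              Gcd {k::int. is_eigenvalue (mat (complex_of_real c) ** D) (of_int k)} = 1)"
proof -
  have D: "D = Mmu \<mu> - mat (complex_of_real c\<^sub>\<mu>)" using assms by simp
  \<comment> \<open>\<open>D\<close> differs from a Hermitian matrix by a real scalar matrix, so it
    is Hermitian as well.\<close>
  have "adj D = adj (Mmu \<mu>) - mat (complex_of_real c\<^sub>\<mu>)"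
    unfolding D by (simp add: vec_eq_iff adj_def mat_def)
  then have "adj D = D" by (simp add: D hermitian_Mmu)
  then obtain v :: "'n \<Rightarrow> complex^'n" and \<kappa> where "\<And>i j. hip (v i) (v j) = of_bool (i = j)"
    and "\<And>i. D *v v i = complex_of_real (\<kappa> i) *s v i"
    using hermitian_orthonormal_eigenvectors[of D UNIV] by (metis UNIV_I)
  then interpret orthonormal_eigenbasis D v \<kappa> by unfold_locales
  have rat: "\<exists>q. \<kappa> i = of_rat q * c\<^sub>\<mu>" for i
    using eigenvalue_rational_multiple[OF assms(2,3)] by metis
  show ?thesis
  proof (cases "\<forall>i. \<kappa> i = 0")
    \<comment> \<open>Here \<open>D = 0\<close>, any positive constant works, and the gcd clause is
      vacuous; it could not hold, because the spectrum is {0}, with gcd 0.\<close>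
    case True
    have "D *v x = 0 *v x" for x
      by (rule eqI) (simp add: hip_D True)
    then have "D = 0" using matrix_eq by blast
    moreover have "\<forall>z. is_eigenvalue (mat (complex_of_real 1) ** D) z \<longrightarrow> z \<in> \<int>"
      unfolding is_eigenvalue_scaled_iff using True by auto
    ultimately show ?thesis using zero_less_one by blast
  next
    case False
    then obtain i0 where i0: "\<kappa> i0 \<noteq> 0" by blast
    obtain a and k :: "'n \<Rightarrow> int" where a: "a > 0" and k: "\<And>i. a * \<kappa> i = of_int (k i)"
      and gcd: "Gcd (range k) = 1"
      by (rule coprime_integer_scaling[where x = \<kappa> and c = "c\<^sub>\<mu>" and ?i0.0 = i0, OF rat i0]) blast
    have ev: "is_eigenvalue (mat (complex_of_real a) ** D) z \<longleftrightarrow> (\<exists>i. z = of_int (k i))" for z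
      by (simp add: is_eigenvalue_scaled_iff k flip: of_real_mult)
    have "{j::int. is_eigenvalue (mat (complex_of_real a) ** D) (of_int j)} = range k"
      by (auto simp: ev)
    with gcd have "Gcd {j::int. is_eigenvalue (mat (complex_of_real a) ** D) (of_int j)} = 1" by simp
    moreover have "\<forall>z. is_eigenvalue (mat (complex_of_real a) ** D) z \<longrightarrow> z \<in> \<int>" by (auto simp: ev)
    ultimately show ?thesis using a by blast
  qed
qed

end
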